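(* Let $F$ be a clause-irreducible unsatisfiable hitting clause-set. The following are equivalent: (i) $F$ has a singular variable; (ii) $F$ has a full variable; (iii) $F$ contains an fs-pair; (iv) $F$ contains a unit-clause; (v) $F=\{\{v\},\{\overline v\}\}$ for some variable $v$.
   Context: Variables are positive integers, literals are nonzero integers, the complement of $x$ is $\overline{x}=-x$. A clause is a finite set of literals with no pair $x,\overline{x}$; a unit-clause is a clause with exactly one literal. A clause-set is a finite set of clauses; $\top$ is the empty clause-set; $c(F)=|F|$. $F$ is satisfiable if some clause meets every clause of $F$, otherwise unsatisfiable. $F$ is hitting if any two distinct clauses $C,D\in F$ have some $x\in C$ with $\overline{x}\in D$. $\mathrm{ldeg}_F(x)$ is the number of clauses containing $x$; a variable $v$ of $F$ is singular if $\min(\mathrm{ldeg}_F(v),\mathrm{ldeg}_F(\overline v))=1$. A full variable of $F$ is a variable occurring in every clause of $F$. An fs-pair is a pair of clauses $\{E\cup\{v\},E\cup\{\overline v\}\}$ with $v,\overline v\notin E$. A clause-set $F'\ne\top$ is a clause-factor if $\{D\setminus\bigcap F':D\in F'\}$ is unsatisfiable; a clause-factor of $F$ is a subset of $F$ which is a clause-factor; trivial if $c(F')=1$ or ($F'$ unsatisfiable and $F'=F$). $F$ is clause-irreducible if all its clause-factors are trivial. *)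

theory Defs
  imports Main
begin

text \<open>
  Literals are nonzero integers, variables are positive integers, and the
  complement of a literal \<open>x\<close> is \<open>- x\<close>.
\<close>

type_synonym lit = int
type_synonym clause = "lit set"
type_synonym clause_set = "clause set"

definition is_clause :: "clause \<Rightarrow> bool" where
  "is_clause C \<longleftrightarrow> finite C \<and> 0 \<notin> C \<and> \<not> (\<exists>x. x \<in> C \<and> - x \<in> C)"

definition is_clause_set :: "clause_set \<Rightarrow> bool" where
  "is_clause_set F \<longleftrightarrow> finite F \<and> (\<forall>C\<in>F. is_clause C)"

definition var_clause :: "clause \<Rightarrow> int set" where
  "var_clause C = {v. v > 0 \<and> (v \<in> C \<or> - v \<in> C)}"

definition var_set :: "clause_set \<Rightarrow> int set" where
  "var_set F = (\<Union>C\<in>F. var_clause C)"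

definition satisfiable :: "clause_set \<Rightarrow> bool" where
  "satisfiable F \<longleftrightarrow> (\<exists>C. is_clause C \<and> (\<forall>D\<in>F. C \<inter> D \<noteq> {}))"

abbreviation unsatisfiable :: "clause_set \<Rightarrow> bool" where
  "unsatisfiable F \<equiv> \<not> satisfiable F"

definition hitting :: "clause_set \<Rightarrow> bool" where
  "hitting F \<longleftrightarrow> (\<forall>C\<in>F. \<forall>D\<in>F. C \<noteq> D \<longrightarrow> (\<exists>x\<in>C. - x \<in> D))"

definition ldeg :: "clause_set \<Rightarrow> lit \<Rightarrow> nat" where
  "ldeg F x = card {C \<in> F. x \<in> C}"

definition singular_variable :: "clause_set \<Rightarrow> int \<Rightarrow> bool" where
  "singular_variable F v \<longleftrightarrow> v \<in> var_set F \<and> min (ldeg F v) (ldeg F (- v)) = 1"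

definition full_variable :: "clause_set \<Rightarrow> int \<Rightarrow> bool" where
  "full_variable F v \<longleftrightarrow> v \<in> var_set F \<and> (\<forall>C\<in>F. v \<in> var_clause C)"

definition unit_clause :: "clause \<Rightarrow> bool" where
  "unit_clause C \<longleftrightarrow> is_clause C \<and> card C = 1"

definition fs_pair :: "clause_set \<Rightarrow> bool" where
  "fs_pair P \<longleftrightarrow> (\<exists>E v. is_clause E \<and> v > 0 \<and> v \<notin> E \<and> - v \<notin> E \<and>
     P = {E \<union> {v}, E \<union> {- v}})"

definition clause_factor :: "clause_set \<Rightarrow> bool" where
  "clause_factor F' \<longleftrightarrow> is_clause_set F' \<and> F' \<noteq> {} \<and> unsatisfiable {D - \<Inter>F' | D. D \<in> F'}"

definition clause_factor_of :: "clause_set \<Rightarrow> clause_set \<Rightarrow> bool" where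
  "clause_factor_of F' F \<longleftrightarrow> F' \<subseteq> F \<and> clause_factor F'"

definition trivial_factor :: "clause_set \<Rightarrow> clause_set \<Rightarrow> bool" where
  "trivial_factor F' F \<longleftrightarrow> card F' = 1 \<or> (unsatisfiable F' \<and> F' = F)"

definition clause_irreducible :: "clause_set \<Rightarrow> bool" where
  "clause_irreducible F \<longleftrightarrow> (\<forall>F'. clause_factor_of F' F \<longrightarrow> trivial_factor F' F)"

end

theory Submission
  imports Defs
begin

text \<open>
  Unsatisfiability of \<open>F\<close> makes certain subsets clause-factors, which clause-irreducibility then
  forces to be trivial. For a full literal \<open>x\<close> these are the clauses containing \<open>x\<close> and those
  containing \<open>-x\<close>, so each consists of a single clause. If \<open>F\<close> contains a unit-clause \<open>{x}\<close>, then
  \<open>x\<close> is full, as \<open>F\<close> is hitting. An fs-pair is itself a clause-factor.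
  If \<open>x\<close> occurs only in the clause \<open>C\<close>, then \<open>C - {x}\<close> is contained in every clause containing
  \<open>-x\<close>, so that the clauses containing \<open>x\<close> or \<open>-x\<close> form a clause-factor; as this is all of \<open>F\<close>,
  the literal \<open>x\<close> is full.
\<close>

lemma satisfiableI:
  assumes "is_clause A" "\<And>D. D \<in> F \<Longrightarrow> A \<inter> D \<noteq> {}"
  shows "satisfiable F"
  using assms unfolding satisfiable_def by blast

lemma is_clause_singleton: "is_clause {x} \<longleftrightarrow> x \<noteq> 0"
  by (auto simp: is_clause_def)

text \<open>A complementary pair across the two parts would be a common element of \<open>A\<close>
  and \<open>C\<close>. This allows part of a satisfying assignment to be replaced by the
  complements of chosen literals.\<close>

lemma is_clause_Un_uminus:
  assumes A: "is_clause A" and C: "is_clause C" and disj: "A \<inter> C = {}"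
  shows "is_clause (A \<union> uminus ` C)"
proof -
  have "- x \<notin> A \<union> uminus ` C" if "x \<in> A \<union> uminus ` C" for x
  proof
    assume "- x \<in> A \<union> uminus ` C"
    then have "- x \<in> A \<or> x \<in> C" by force
    moreover have "x \<in> A \<or> - x \<in> C" using that by force
    ultimately show False using A C disj unfolding is_clause_def by blast
  qed
  moreover have "finite (A \<union> uminus ` C)" "0 \<notin> A \<union> uminus ` C"
    using A C by (auto simp: is_clause_def)
  ultimately show ?thesis unfolding is_clause_def by blast
qed

lemma clause_factor_full_literal:
  assumes F: "is_clause_set F" and unsat: "unsatisfiable F" and x: "x \<noteq> 0"
    and full: "\<And>C. C \<in> F \<Longrightarrow> x \<in> C \<or> - x \<in> C"
  shows "clause_factor {C \<in> F. x \<in> C}"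
  unfolding clause_factor_def
proof (intro conjI notI)
  let ?G = "{C \<in> F. x \<in> C}"
  show "is_clause_set ?G" using F by (auto simp: is_clause_set_def)
  \<comment> \<open>If no clause contained \<open>x\<close>, the assignment \<open>{- x}\<close>
    would meet all of \<open>F\<close>.\<close>
  show False if "?G = {}"
    using unsat satisfiableI[of "{- x}" F] full that x by (auto simp: is_clause_singleton)
  show False if sat: "satisfiable {D - \<Inter>?G | D. D \<in> ?G}"
  proof -
    obtain A where A: "is_clause A" and m: "\<forall>E\<in>{D - \<Inter>?G | D. D \<in> ?G}. A \<inter> E \<noteq> {}"
      using sat unfolding satisfiable_def by (elim exE conjE)
    have meets: "A \<inter> (D - \<Inter>?G) \<noteq> {}" if "D \<in> ?G" for D
      by (rule bspec[OF m]) (use that in blast)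
    \<comment> \<open>Since \<open>x\<close> lies in the intersection of \<open>?G\<close>,
      \<open>A\<close> meets the clauses of \<open>?G\<close> in literals other than
      \<open>x\<close>. Switching to \<open>- x\<close> keeps these and meets all other clauses of
      \<open>F\<close>.\<close>
    define B where "B = insert (- x) (A - {x})"
    have "is_clause B" using A x by (auto simp: is_clause_def B_def)
    moreover have "B \<inter> D \<noteq> {}" if D: "D \<in> F" for D
    proof (cases "x \<in> D")
      case True
      then obtain y where "y \<in> A" "y \<in> D" "y \<notin> \<Inter>?G" using meets[of D] D by auto
      then have "y \<in> B \<inter> D" by (auto simp: B_def)
      then show ?thesis by blast
    next
      case False
      then show ?thesis using full[OF D] by (auto simp: B_def)
    qed
    ultimately show False using unsat satisfiableI by blast
  qed
qed

lemma full_literal_imp_unit_pair: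
  assumes F: "is_clause_set F" and unsat: "unsatisfiable F" and irr: "clause_irreducible F"
    and x: "x \<noteq> 0" and full: "\<And>C. C \<in> F \<Longrightarrow> x \<in> C \<or> - x \<in> C"
  shows "F = {{x}, {- x}}"
proof -
  \<comment> \<open>Stated for any full literal \<open>y\<close>, to be applied to both
    \<open>x\<close> and \<open>- x\<close>. The assignment \<open>{y}\<close> satisfies the factor,
    so only the one-clause form of triviality remains.\<close>
  have single: "\<exists>C. {C \<in> F. y \<in> C} = {C}"
    if y: "y \<noteq> 0" and fy: "\<And>C. C \<in> F \<Longrightarrow> y \<in> C \<or> - y \<in> C" for y
  proof -
    have "satisfiable {C \<in> F. y \<in> C}"
      using satisfiableI[of "{y}" "{C \<in> F. y \<in> C}"] y by (auto simp: is_clause_singleton)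
    moreover have "clause_factor {C \<in> F. y \<in> C}"
      using clause_factor_full_literal[OF F unsat y fy] by blast
    moreover from this have "trivial_factor {C \<in> F. y \<in> C} F"
      using irr by (simp add: clause_irreducible_def clause_factor_of_def)
    ultimately have "card {C \<in> F. y \<in> C} = 1" unfolding trivial_factor_def by argo
    then show ?thesis by (rule card_1_singletonE) blast
  qed
  obtain C where C: "{C \<in> F. x \<in> C} = {C}" using single[OF x full] by blast
  obtain D where D: "{C \<in> F. - x \<in> C} = {D}" using single[of "- x"] x full by force
  have CD: "is_clause C" "is_clause D" "x \<in> C" "- x \<in> D" "F = {C, D}"
    using C D F full unfolding is_clause_set_def by blast+
  \<comment> \<open>A second literal \<open>a\<close> of \<open>C\<close> would meet
    \<open>C\<close>, leaving \<open>- x\<close> free to meet \<open>D\<close>.\<close>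
  have False if "a \<in> C" "a \<noteq> x" for a
  proof -
    have "is_clause {a, - x}" using that CD x by (auto simp: is_clause_def)
    then show False using unsat satisfiableI[of "{a, - x}" F] CD that by auto
  qed
  moreover have False if "a \<in> D" "a \<noteq> - x" for a
  proof -
    have "is_clause {a, x}" using that CD x by (auto simp: is_clause_def)
    then show False using unsat satisfiableI[of "{a, x}" F] CD that by auto
  qed
  ultimately have "C = {x}" "D = {- x}" using CD by blast+
  then show ?thesis using CD by simp
qed

text \<open>Removing the common part \<open>E\<close> leaves \<open>{{v}, {- v}}\<close>, which no
  clause satisfies. As \<open>P\<close> has two clauses, triviality makes it equal to
  \<open>F\<close> and unsatisfiable; any literal of \<open>E\<close> would satisfy both clauses, so
  \<open>E\<close> is empty.\<close>

lemma fs_pair_imp_unit_pair: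
  assumes F: "is_clause_set F" and irr: "clause_irreducible F" and P: "fs_pair P" "P \<subseteq> F"
  shows "\<exists>v>0. F = {{v}, {- v}}"
proof -
  obtain E v where E: "is_clause E" "v > 0" "v \<notin> E" "- v \<notin> E"
    and Pdef: "P = {E \<union> {v}, E \<union> {- v}}"
    using P unfolding fs_pair_def by blast
  have "E \<union> {v} \<noteq> E \<union> {- v}" using E by auto
  then have card: "card P \<noteq> 1" unfolding Pdef by simp
  have "\<Inter>P = E" using E unfolding Pdef by auto
  moreover have "{D - E | D. D \<in> P} = (\<lambda>D. D - E) ` P" by (rule Setcompr_eq_image)
  moreover have "(E \<union> {v}) - E = {v}" "(E \<union> {- v}) - E = {- v}" using E by auto
  ultimately have "{D - \<Inter>P | D. D \<in> P} = {{v}, {- v}}" by (simp only: Pdef image_insert image_empty)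
  moreover have "unsatisfiable {{v}, {- v}}"
    by (auto simp: satisfiable_def is_clause_def)
  moreover have "is_clause_set P" using F P finite_subset unfolding is_clause_set_def by blast
  moreover have "P \<noteq> {}" unfolding Pdef by blast
  ultimately have "clause_factor P" by (simp add: clause_factor_def)
  then have "trivial_factor P F"
    using irr P by (simp add: clause_irreducible_def clause_factor_of_def)
  then have "unsatisfiable P" "P = F" using card unfolding trivial_factor_def by argo+
  moreover have "satisfiable P" if "e \<in> E" for e
    using satisfiableI[of "{e}" P] that E by (auto simp: Pdef is_clause_def)
  ultimately show ?thesis using E Pdef by blast
qed

lemma unit_clause_imp_full_literal:
  assumes "hitting F" "{x} \<in> F" "C \<in> F"
  shows "x \<in> C \<or> - x \<in> C"
  using assms unfolding hitting_def by blast

lemma singular_clause_subset: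
  assumes F: "is_clause_set F" and unsat: "unsatisfiable F" and hit: "hitting F"
    and C: "{C \<in> F. x \<in> C} = {C}" and D: "D \<in> F" "- x \<in> D"
  shows "C - {x} \<subseteq> D"
proof
  fix y assume y: "y \<in> C - {x}"
  show "y \<in> D"
  proof (rule ccontr)
    assume "y \<notin> D"
    have uniq: "G = C" if "G \<in> F" "x \<in> G" for G using C that by blast
    have cl: "is_clause C" "is_clause D" using C D F unfolding is_clause_set_def by blast+
    \<comment> \<open>\<open>A\<close> falsifies every literal of \<open>D\<close> except
      \<open>- x\<close>. It meets \<open>D\<close> in \<open>- x\<close> and \<open>C\<close>, the
      only clause with \<open>x\<close>, in \<open>y\<close>. Any other clause clashes with
      \<open>D\<close>, and not at \<open>- x\<close> because it lacks \<open>x\<close>, so it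
      contains a falsified literal's complement.\<close>
    define A where "A = {y, - x} \<union> uminus ` (D - {- x})"
    have "is_clause {y, - x}" using cl y D by (auto simp: is_clause_def)
    moreover have "is_clause (D - {- x})" using cl by (auto simp: is_clause_def)
    ultimately have "is_clause A"
      unfolding A_def using \<open>y \<notin> D\<close> by (intro is_clause_Un_uminus) auto
    moreover have "A \<inter> G \<noteq> {}" if G: "G \<in> F" for G
    proof (cases "x \<in> G \<or> G = D")
      case True
      then show ?thesis using uniq[OF G] y D unfolding A_def by blast
    next
      case False
      then obtain z where "z \<in> D" "- z \<in> G" using hit D G unfolding hitting_def by blast
      then have "- z \<in> A \<inter> G" using False by (auto simp: A_def)
      then show ?thesis by blast
    qed
    ultimately show False using unsat satisfiableI by blast
  qed
qed

lemma singular_imp_full_literal: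
  assumes F: "is_clause_set F" and unsat: "unsatisfiable F" and hit: "hitting F"
    and irr: "clause_irreducible F"
    and C: "{C \<in> F. x \<in> C} = {C}" and D: "D \<in> F" "- x \<in> D" and G: "G \<in> F"
  shows "x \<in> G \<or> - x \<in> G"
proof -
  define P where "P = {G \<in> F. x \<in> G \<or> - x \<in> G}"
  have sub: "C - {x} \<subseteq> G" if "G \<in> F" "- x \<in> G" for G
    using singular_clause_subset[OF F unsat hit C that] .
  have CF: "C \<in> F" "x \<in> C" "is_clause C" "is_clause D"
    using C D F unfolding is_clause_set_def by blast+
  have "x \<notin> D" using CF D by (auto simp: is_clause_def)
  have CP: "G = C \<or> - x \<in> G" if "G \<in> P" for G
    using that C unfolding P_def by blast
  have "C \<in> P" "D \<in> P" "C \<noteq> D" using CF D \<open>x \<notin> D\<close> by (auto simp: P_def)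
  then have "card P \<noteq> 1" using card_1_singletonE by blast
  \<comment> \<open>The clause \<open>D\<close> removes \<open>x\<close> from the intersection; the
    rest of \<open>C\<close> survives by \<open>sub\<close>.\<close>
  have I: "\<Inter>P = C - {x}"
  proof
    show "\<Inter>P \<subseteq> C - {x}" using \<open>C \<in> P\<close> \<open>D \<in> P\<close> \<open>x \<notin> D\<close> by blast
    show "C - {x} \<subseteq> \<Inter>P" using CP sub P_def by blast
  qed
  have "unsatisfiable {D - \<Inter>P | D. D \<in> P}"
  proof
    assume "satisfiable {D - \<Inter>P | D. D \<in> P}"
    then obtain A where A: "is_clause A" and m: "\<forall>E\<in>{D - (C - {x}) | D. D \<in> P}. A \<inter> E \<noteq> {}"
      unfolding satisfiable_def I by (elim exE conjE)
    have meets: "A \<inter> (D - (C - {x})) \<noteq> {}" if "D \<in> P" for D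
      by (rule bspec[OF m]) (use that in blast)
    have "x \<in> A" using meets[OF \<open>C \<in> P\<close>] by blast
    \<comment> \<open>\<open>A\<close> meets the clauses of \<open>P\<close> outside
      \<open>C - {x}\<close>, so its values on \<open>C - {x}\<close> may be changed to falsify that
      set. Clauses outside \<open>P\<close> clash with \<open>C\<close>, and are then met by the
      complements.\<close>
    define B where "B = (A - (C - {x})) \<union> uminus ` (C - {x})"
    have "is_clause (A - (C - {x}))" "is_clause (C - {x})"
      using A CF by (auto simp: is_clause_def)
    then have "is_clause B" unfolding B_def by (intro is_clause_Un_uminus) auto
    moreover have "B \<inter> G \<noteq> {}" if G: "G \<in> F" for G
    proof (cases "G \<in> P")
      case True
      then show ?thesis using meets[OF True] unfolding B_def by blast
    next
      case False
      then have "C \<noteq> G" using \<open>C \<in> P\<close> by blast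
      then obtain z where z: "z \<in> C" "- z \<in> G"
        using hit CF(1) G unfolding hitting_def by meson
      \<comment> \<open>A clash at \<open>x\<close> would put \<open>- x\<close> in
        \<open>G\<close>, hence \<open>G\<close> in \<open>P\<close>.\<close>
      then have "z \<noteq> x" using False G unfolding P_def by blast
      then have "- z \<in> B \<inter> G" using z unfolding B_def by blast
      then show ?thesis by blast
    qed
    ultimately show False using unsat satisfiableI by blast
  qed
  moreover have "is_clause_set P" using F by (auto simp: is_clause_set_def P_def)
  ultimately have "clause_factor_of P F"
    using \<open>C \<in> P\<close> by (auto simp: clause_factor_of_def clause_factor_def P_def)
  then have "P = F"
    using irr \<open>card P \<noteq> 1\<close> by (auto simp: clause_irreducible_def trivial_factor_def)
  then show ?thesis using G P_def by blast
qed

text \<open>Take for \<open>x\<close> whichever of \<open>v\<close> and \<open>- v\<close> attains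
  the minimum degree 1; the degree of the other is at least 1, which supplies
  \<open>D\<close>.\<close>

lemma singular_variable_literal:
  assumes v: "singular_variable F v"
  obtains x C D where "x \<noteq> 0" "\<bar>x\<bar> = v" "{C \<in> F. x \<in> C} = {C}" "D \<in> F" "- x \<in> D"
proof -
  note witness = that
  have "v > 0" using v by (auto simp: singular_variable_def var_set_def var_clause_def)
  have thesis if x: "\<bar>x\<bar> = v" "ldeg F x = 1" "ldeg F (- x) \<ge> 1" for x
  proof -
    obtain C where "{C \<in> F. x \<in> C} = {C}"
      using x(2) unfolding ldeg_def by (rule card_1_singletonE)
    moreover have "{C \<in> F. - x \<in> C} \<noteq> {}"
      using x(3) unfolding ldeg_def by (metis card.empty not_one_le_zero)
    then obtain D where "D \<in> F" "- x \<in> D" by blast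
    ultimately show thesis using witness[of x C D] x(1) \<open>v > 0\<close> by simp
  qed
  from this[of v] this[of "- v"] show thesis
    using v \<open>v > 0\<close> by (auto simp: singular_variable_def min_def split: if_splits)
qed

theorem lemma18:
  fixes F :: clause_set
  assumes "is_clause_set F"
    and "unsatisfiable F"
    and "hitting F"
    and "clause_irreducible F"
  shows "((\<exists>v. singular_variable F v) \<longleftrightarrow> (\<exists>v. full_variable F v))
       \<and> ((\<exists>v. full_variable F v) \<longleftrightarrow> (\<exists>P. fs_pair P \<and> P \<subseteq> F))
       \<and> ((\<exists>P. fs_pair P \<and> P \<subseteq> F) \<longleftrightarrow> (\<exists>C\<in>F. unit_clause C))
       \<and> ((\<exists>C\<in>F. unit_clause C) \<longleftrightarrow> (\<exists>v>0. F = {{v}, {- v}}))"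
proof -
  let ?pair = "\<exists>v>0. F = {{v}, {- v}}"
  have full: ?pair if "x \<noteq> 0" "\<And>C. C \<in> F \<Longrightarrow> x \<in> C \<or> - x \<in> C" for x
  proof -
    have "F = {{x}, {- x}}"
      using full_literal_imp_unit_pair[OF assms(1,2,4)] that by blast
    \<comment> \<open>The full literal may be negative; the pair is symmetric under complement, so
      it can be named by its variable.\<close>
    then have "F = {{\<bar>x\<bar>}, {- \<bar>x\<bar>}}" by (auto simp: abs_if)
    then show ?pair using that(1) zero_less_abs_iff by blast
  qed
  have sing: ?pair if v: "singular_variable F v" for v
  proof -
    obtain x C D where x: "x \<noteq> 0" and D: "{C \<in> F. x \<in> C} = {C}" "D \<in> F" "- x \<in> D"
      by (rule singular_variable_literal[OF v])
    show ?pair by (rule full[OF x singular_imp_full_literal[OF assms D]])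
  qed
  have fullv: ?pair if "full_variable F v" for v
  proof (rule full)
    show "v \<noteq> 0" using that by (auto simp: full_variable_def var_set_def var_clause_def)
    show "\<And>C. C \<in> F \<Longrightarrow> v \<in> C \<or> - v \<in> C"
      using that by (auto simp: full_variable_def var_clause_def)
  qed
  have fs: ?pair if "fs_pair P" "P \<subseteq> F" for P
    using fs_pair_imp_unit_pair[OF assms(1,4) that] .
  have unit: ?pair if "C \<in> F" "unit_clause C" for C
  proof -
    obtain x where x: "C = {x}" "x \<noteq> 0"
      using \<open>unit_clause C\<close> unfolding unit_clause_def
      by (metis card_1_singletonE is_clause_singleton)
    then show ?pair using full unit_clause_imp_full_literal[OF assms(3)] that(1) by blast
  qed
  have witness: "singular_variable F v \<and> full_variable F v \<and> fs_pair F \<and> {v} \<in> F \<and> unit_clause {v}"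
    if v: "v > 0" "F = {{v}, {- v}}" for v
  proof -
    have "{C \<in> F. v \<in> C} = {{v}}" "{C \<in> F. - v \<in> C} = {{- v}}" using v by auto
    then have "ldeg F v = 1" "ldeg F (- v) = 1" by (simp_all add: ldeg_def)
    \<comment> \<open>The common part is the empty clause.\<close>
    moreover have "fs_pair F"
      unfolding fs_pair_def by (rule exI[of _ "{}"], rule exI[of _ v]) (use v in \<open>auto simp: is_clause_def\<close>)
    ultimately show ?thesis using v
      by (auto simp: singular_variable_def full_variable_def var_set_def var_clause_def
          unit_clause_def is_clause_singleton)
  qed
  have conv: "(\<exists>v. singular_variable F v) \<and> (\<exists>v. full_variable F v)
      \<and> (\<exists>P. fs_pair P \<and> P \<subseteq> F) \<and> (\<exists>C\<in>F. unit_clause C)" if ?pair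
  proof -
    from that obtain v where "v > 0" "F = {{v}, {- v}}" by (elim exE conjE)
    from witness[OF this] show ?thesis by (meson subset_refl)
  qed
  \<comment> \<open>All equivalences pass through \<open>?pair\<close>: each condition implies it,
    and \<open>conv\<close> returns all of them.\<close>
  have "(\<exists>v. singular_variable F v) \<Longrightarrow> ?pair" by (elim exE) (rule sing)
  moreover have "(\<exists>v. full_variable F v) \<Longrightarrow> ?pair" by (elim exE) (rule fullv)
  moreover have "(\<exists>P. fs_pair P \<and> P \<subseteq> F) \<Longrightarrow> ?pair" by (elim exE conjE) (rule fs)
  moreover have "(\<exists>C\<in>F. unit_clause C) \<Longrightarrow> ?pair" by (elim bexE) (rule unit)
  ultimately show ?thesis using conv by argo
qed

end
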